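(* For integers $m,n\ge 1$ let \[ D(m,n)=\min_{K\in\mathbb{Z}}\sum_{i=1}^{m}\sum_{j=1}^{n}\bigl|(i+j)-K\bigr| . \] Then the diameter of $\mathrm{OFG}(M_{m,n})$ satisfies $\operatorname{diam}\mathrm{OFG}(M_{m,n})\ge D(m,n)$ for all $m,n\ge 1$. The quantity $D(m,n)$ is symmetric in $(m,n)$ and satisfies \begin{align*} D(2,n)&=\Big\lceil \tfrac{n^2}{2}\Big\rceil,\\ D(3,n)&=\Big\lfloor \tfrac{3n^2}{4}\Big\rfloor+2,\\ D(4,n)&=n^2+4+[\,n\text{ odd}\,]\qquad(n\ge 2),\\ D(m,m)&=\tfrac{m^3-m}{3}. \end{align*}
   Context: $G_{m,n}$ is the grid graph with vertex set $\{(i,j): 1\le i\le m,\ 1\le j\le n\}$, each vertex joined to its horizontal and vertical neighbours. A proper $3$-colouring is a map $c:V(G_{m,n})\to\mathbb{Z}/3\mathbb{Z}$ with $c(u)\ne c(v)$ for every edge $uv$. $\mathrm{OFG}(M_{m,n})$ is the origami flip graph of the $m\times n$ Miura-ori (vertices: flat-foldable mountain--valley assignments; edges: single face flips). Throughout it is identified, by a known bijection, with the following simple graph: its vertices are the orbits of proper $3$-colourings of $G_{m,n}$ under the global colour rotation $c\mapsto c+1$ (action of $\mathbb{Z}/3\mathbb{Z}$), and two distinct orbits are adjacent if and only if they contain representatives that differ at exactly one vertex of $G_{m,n}$. This graph is connected, and its diameter is the largest graph distance between two vertices. $[\,n\text{ odd}\,]$ is $1$ if $n$ is odd and $0$ otherwise.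 *)

theory Defs
  imports "Graph_Theory.Graph_Theory" "HOL-Library.Numeral_Type" "HOL-Library.FuncSet"
begin

text \<open>Undirected graphs are symmetric, loop-free pair digraphs (\<open>pair_graph\<close>).\<close>

definition grid_graph :: "nat \<Rightarrow> nat \<Rightarrow> (nat \<times> nat) pair_pre_digraph" where
  "grid_graph m n =
     \<lparr> pverts = {1..m} \<times> {1..n},
       parcs = {((i, j), (i', j')).
         i \<in> {1..m} \<and> i' \<in> {1..m} \<and> j \<in> {1..n} \<and> j' \<in> {1..n} \<and>
         (i = i' \<and> (j' = j + 1 \<or> j = j' + 1) \<or> j = j' \<and> (i' = i + 1 \<or> i = i' + 1))} \<rparr>"

text \<open>
  The numeral type \<open>3\<close> is \<open>\<int>/3\<int>\<close>, with addition modulo 3.  Colourings are taken extensional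
  (\<open>undefined\<close> off the vertex set), so that equality of colourings is equality on the vertices.
\<close>

definition proper_3_colourings :: "'a pair_pre_digraph \<Rightarrow> ('a \<Rightarrow> 3) set" where
  "proper_3_colourings G =
     {c \<in> pverts G \<rightarrow>\<^sub>E UNIV. \<forall>(u, v) \<in> parcs G. c u \<noteq> c v}"

definition rotate_colouring :: "'a pair_pre_digraph \<Rightarrow> 3 \<Rightarrow> ('a \<Rightarrow> 3) \<Rightarrow> ('a \<Rightarrow> 3)" where
  "rotate_colouring G k c = (\<lambda>v\<in>pverts G. c v + k)"

definition rotation_orbit :: "'a pair_pre_digraph \<Rightarrow> ('a \<Rightarrow> 3) \<Rightarrow> ('a \<Rightarrow> 3) set" where
  "rotation_orbit G c = range (\<lambda>k. rotate_colouring G k c)"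

definition OFG :: "nat \<Rightarrow> nat \<Rightarrow> (nat \<times> nat \<Rightarrow> 3) set pair_pre_digraph" where
  "OFG m n = (let G = grid_graph m n; V = rotation_orbit G ` proper_3_colourings G in
     \<lparr> pverts = V,
       parcs = {(A, B). A \<in> V \<and> B \<in> V \<and> A \<noteq> B \<and>
         (\<exists>c \<in> A. \<exists>d \<in> B. \<exists>!v. v \<in> pverts G \<and> c v \<noteq> d v)} \<rparr>)"

text \<open>
  Distances are least lengths of walks (\<open>\<mu>\<close> with unit arc weights), with value \<open>\<infinity>\<close> between
  different components.
\<close>

definition graph_dist :: "'a pair_pre_digraph \<Rightarrow> 'a \<Rightarrow> 'a \<Rightarrow> ereal" where
  "graph_dist G u v = wf_digraph.\<mu> (with_proj G) (\<lambda>_. 1) u v"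

definition graph_diameter :: "'a pair_pre_digraph \<Rightarrow> ereal" where
  "graph_diameter G = (SUP (u, v) \<in> pverts G \<times> pverts G. graph_dist G u v)"

definition Dmin :: "nat \<Rightarrow> nat \<Rightarrow> int" where
  "Dmin m n = (LEAST s. \<exists>K::int. s = (\<Sum>i=1..m. \<Sum>j=1..n. \<bar>(int i + int j) - K\<bar>))"

lemma pair_graph_grid_graph: "pair_graph (grid_graph m n)"
proof
  have "parcs (grid_graph m n) \<subseteq> pverts (grid_graph m n) \<times> pverts (grid_graph m n)"
    by (auto simp: grid_graph_def)
  then show "finite (parcs (grid_graph m n))"
    by (rule finite_subset) (simp add: grid_graph_def)
qed (auto simp: grid_graph_def symmetric_def sym_def)

lemma finite_proper_3_colourings:
  assumes "finite (pverts G)"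
  shows "finite (proper_3_colourings G)"
  unfolding proper_3_colourings_def
  by (rule finite_subset[of _ "pverts G \<rightarrow>\<^sub>E UNIV"]) (use assms in \<open>auto intro!: finite_PiE\<close>)

lemma pair_graph_OFG: "pair_graph (OFG m n)"
proof
  have fin: "finite (pverts (OFG m n))"
    by (auto simp: OFG_def Let_def grid_graph_def intro!: finite_proper_3_colourings)
  then show "finite (pverts (OFG m n))" .
  have "parcs (OFG m n) \<subseteq> pverts (OFG m n) \<times> pverts (OFG m n)"
    by (auto simp: OFG_def Let_def)
  then show "finite (parcs (OFG m n))"
    by (rule finite_subset) (simp add: fin)
  have "(B, A) \<in> parcs (OFG m n)" if "(A, B) \<in> parcs (OFG m n)" for A B
  proof -
    have *: "c v \<noteq> d v \<longleftrightarrow> d v \<noteq> c v" for c d :: "nat \<times> nat \<Rightarrow> 3" and v by auto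
    from that obtain c d where "c \<in> A" "d \<in> B"
      "\<exists>!v. v \<in> pverts (grid_graph m n) \<and> c v \<noteq> d v"
      by (auto simp: OFG_def Let_def)
    then have "\<exists>d\<in>B. \<exists>c\<in>A. \<exists>!v. v \<in> pverts (grid_graph m n) \<and> d v \<noteq> c v"
      by (subst (asm) *) blast
    with that show ?thesis
      unfolding OFG_def Let_def by simp blast
  qed
  then show "symmetric (with_proj (OFG m n))"
    by (simp add: symmetric_def sym_def)
qed (auto simp: OFG_def Let_def)

end

theory Submission
  imports Defs
begin

text \<open>
  A proper 3-colouring of the grid is the reduction modulo 3 of an integer height function whose
  values on neighbours differ by 1, and recolouring one vertex moves its height by \<open>\<plusminus>2\<close>.  Along a
  walk of length \<open>l\<close> from the orbit of \<open>i + j\<close> to the orbit of \<open>-(i + j)\<close> the height therefore changes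
  by at most \<open>2l\<close> in total.  Heights with colourings in the same orbit differ by a constant, and this
  constant is even by parity, so the total change is
  \<open>\<Sum>\<bar>2K - 2(i + j)\<bar>\<close> for some integer \<open>K\<close>.  The closed forms come from a recursion in steps of 2 for
  the centred sum \<open>\<Sum>\<bar>2(i + j) - (m + n + 2)\<bar>\<close>, which is \<open>2 D(m,n)\<close> by the symmetry of the grid.
\<close>

section \<open>The median sum\<close>

definition grid_sum :: "nat \<Rightarrow> nat \<Rightarrow> int \<Rightarrow> int" where
  "grid_sum m n K = (\<Sum>i=1..m. \<Sum>j=1..n. \<bar>(int i + int j) - K\<bar>)"

text \<open>Doubled so that all terms are integers: the centre (m + n + 2) / 2 of the values i + j
  is a half-integer when m + n is odd.\<close>

definition centred_sum :: "nat \<Rightarrow> nat \<Rightarrow> int" where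
  "centred_sum m n = (\<Sum>i=1..m. \<Sum>j=1..n. \<bar>2 * (int i + int j) - (int m + int n + 2)\<bar>)"

text \<open>The half turn sending (i, j) to (m + 1 - i, n + 1 - j) permutes the grid.\<close>

lemma grid_sum_reflect:
  "grid_sum m n K = (\<Sum>i=1..m. \<Sum>j=1..n. \<bar>(int m + int n + 2 - (int i + int j)) - K\<bar>)"
proof -
  have "grid_sum m n K = (\<Sum>i=1..m. \<Sum>j=1..n. \<bar>(int (m + 1 - i) + int (n + 1 - j)) - K\<bar>)"
    unfolding grid_sum_def
    by (subst sum.atLeastAtMost_rev, rule sum.cong[OF refl], subst sum.atLeastAtMost_rev) simp
  also have "\<dots> = (\<Sum>i=1..m. \<Sum>j=1..n. \<bar>(int m + int n + 2 - (int i + int j)) - K\<bar>)"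
    by (intro sum.cong refl arg_cong[of _ _ abs]) (auto simp: of_nat_diff)
  finally show ?thesis .
qed

lemma double_grid_sum:
  "2 * grid_sum m n K =
     (\<Sum>i=1..m. \<Sum>j=1..n. \<bar>(int i + int j) - K\<bar> + \<bar>(int m + int n + 2 - (int i + int j)) - K\<bar>)"
proof -
  have "2 * grid_sum m n K = grid_sum m n K + grid_sum m n K"
    by simp
  also have "\<dots> = (\<Sum>i=1..m. \<Sum>j=1..n. \<bar>(int i + int j) - K\<bar>) +
      (\<Sum>i=1..m. \<Sum>j=1..n. \<bar>(int m + int n + 2 - (int i + int j)) - K\<bar>)"
    by (subst (2) grid_sum_reflect) (simp only: grid_sum_def)
  finally show ?thesis
    by (simp only: sum.distrib)
qed

text \<open>Triangle inequality for each cell: x and its mirror image s - x lie at distance \<bar>2x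
  - s\<bar>, whatever K is.\<close>

lemma centred_sum_le: "centred_sum m n \<le> 2 * grid_sum m n K"
proof -
  have *: "\<bar>2 * x - s\<bar> \<le> \<bar>x - K\<bar> + \<bar>(s - x) - K\<bar>" for x s :: int
    by arith
  show ?thesis
    unfolding double_grid_sum centred_sum_def by (intro sum_mono *)
qed

text \<open>Equality in the triangle inequality: the rounded midpoint \<open>s div 2\<close> always
  lies between the integers x and s - x.\<close>

lemma centred_sum_eq: "centred_sum m n = 2 * grid_sum m n ((int m + int n + 2) div 2)"
proof -
  have *: "\<bar>2 * x - s\<bar> = \<bar>x - s div 2\<bar> + \<bar>(s - x) - s div 2\<bar>" for x s :: int
  proof -
    have "s = 2 * (s div 2) \<or> s = 2 * (s div 2) + 1"
      by presburger
    then show ?thesis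
      by arith
  qed
  show ?thesis
    unfolding double_grid_sum centred_sum_def by (intro sum.cong refl *)
qed

lemma Dmin_eq: "Dmin m n = grid_sum m n ((int m + int n + 2) div 2)"
  unfolding Dmin_def
proof (rule Least_equality)
  fix s assume "\<exists>K. s = (\<Sum>i=1..m. \<Sum>j=1..n. \<bar>(int i + int j) - K\<bar>)"
  then obtain K where "s = grid_sum m n K"
    by (auto simp: grid_sum_def)
  then show "grid_sum m n ((int m + int n + 2) div 2) \<le> s"
    using centred_sum_le[of m n K] centred_sum_eq[of m n] by simp
qed (auto simp: grid_sum_def)

lemma double_Dmin: "2 * Dmin m n = centred_sum m n"
  by (simp add: Dmin_eq centred_sum_eq)

lemma Dmin_le: "Dmin m n \<le> grid_sum m n K"
  using centred_sum_le[of m n K] double_Dmin[of m n] by simp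

lemma Dmin_commute: "Dmin m n = Dmin n m"
proof -
  have "centred_sum m n = centred_sum n m"
    unfolding centred_sum_def by (subst sum.swap) (simp add: algebra_simps)
  then show ?thesis
    using double_Dmin[of m n] double_Dmin[of n m] by simp
qed

text \<open>Two new columns, one on each side, leave the centre of the old columns unchanged.\<close>

lemma Dmin_add_2:
  assumes "m \<le> n + 2"
  shows "Dmin m (n + 2) = Dmin m n + int m * (int n + 1)"
proof -
  have split: "(\<Sum>j=1..n+2. f j) = f 1 + f (n + 2) + (\<Sum>j=1..n. f (j + 1))" for f :: "nat \<Rightarrow> int"
  proof -
    have "(\<Sum>j=1..n+2. f j) = (\<Sum>j=1..Suc n. f j) + f (n + 2)"
      by simp
    also have "(\<Sum>j=1..Suc n. f j) = f 1 + (\<Sum>j=Suc 1..Suc n. f j)"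
      by (rule sum.atLeast_Suc_atMost) simp
    finally show ?thesis
      by (simp only: sum.shift_bounds_cl_Suc_ivl) simp
  qed
  have "centred_sum m (n + 2) =
      (\<Sum>i=1..m. 2 * (int n + 1) + (\<Sum>j=1..n. \<bar>2 * (int i + int j) - (int m + int n + 2)\<bar>))"
    unfolding centred_sum_def split
  proof (intro sum.cong refl arg_cong2[of _ _ _ _ "(+)"])
    fix i assume "i \<in> {1..m}"
    \<comment> \<open>Since 1 \<le> i \<le> m \<le> n + 2, the first argument is at most 0 and the
      second at least 0, so i cancels in the sum of the absolute values.\<close>
    with assms show "\<bar>2 * (int i + int 1) - (int m + int (n + 2) + 2)\<bar> +
        \<bar>2 * (int i + int (n + 2)) - (int m + int (n + 2) + 2)\<bar> = 2 * (int n + 1)"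
      by auto
  qed auto
  also have "\<dots> = 2 * (int m * (int n + 1)) + centred_sum m n"
    by (simp add: sum.distrib centred_sum_def algebra_simps)
  finally show ?thesis
    using double_Dmin[of m n] double_Dmin[of m "n + 2"] by simp
qed

section \<open>Starting values and closed forms\<close>

lemma Dmin_base:
  "Dmin 0 0 = 0" "Dmin 1 1 = 0" "Dmin 2 1 = 1" "Dmin 2 2 = 2" "Dmin 3 1 = 2" "Dmin 3 2 = 5"
  "Dmin 4 2 = 8" "Dmin 4 3 = 14"
  by (simp_all add: Dmin_eq grid_sum_def numeral_eq_Suc)

text \<open>The recursion keeps the parity of n, so each closed form needs two consecutive starting
  values.\<close>

lemma parity_induct [case_names base0 base1 step]:
  assumes "P n0" "P (Suc n0)" "\<And>n. n0 \<le> n \<Longrightarrow> P n \<Longrightarrow> P (n + 2)" "n0 \<le> n"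
  shows "P (n::nat)"
proof -
  have "P n \<and> P (Suc n)"
    using assms(4) by (induction rule: dec_induct) (use assms in auto)
  then show ?thesis ..
qed

lemma Dmin_2:
  assumes "1 \<le> n"
  shows "Dmin 2 n = \<lceil>real n ^ 2 / 2\<rceil>"
proof (rule parity_induct[of _ 1, OF _ _ _ assms])
  fix n :: nat assume n: "1 \<le> n" and IH: "Dmin 2 n = \<lceil>real n ^ 2 / 2\<rceil>"
  \<comment> \<open>The increment is an integer and therefore passes through the rounding.\<close>
  have "real (n + 2) ^ 2 / 2 = real n ^ 2 / 2 + of_int (2 * (int n + 1))"
    by (simp add: power2_eq_square field_simps)
  then have "\<lceil>real (n + 2) ^ 2 / 2\<rceil> = \<lceil>real n ^ 2 / 2\<rceil> + 2 * (int n + 1)"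
    by (metis ceiling_add_of_int)
  then show "Dmin 2 (n + 2) = \<lceil>real (n + 2) ^ 2 / 2\<rceil>"
    using Dmin_add_2[of 2 n] n IH by simp
next
  show "Dmin 2 1 = \<lceil>real 1 ^ 2 / 2\<rceil>" "Dmin 2 (Suc 1) = \<lceil>real (Suc 1) ^ 2 / 2\<rceil>"
    using Dmin_base by (simp_all add: numeral_2_eq_2[symmetric] ceiling_eq_iff)
qed

lemma Dmin_3:
  assumes "1 \<le> n"
  shows "Dmin 3 n = \<lfloor>3 * real n ^ 2 / 4\<rfloor> + 2"
proof (rule parity_induct[of _ 1, OF _ _ _ assms])
  fix n :: nat assume n: "1 \<le> n" and IH: "Dmin 3 n = \<lfloor>3 * real n ^ 2 / 4\<rfloor> + 2"
  have "3 * real (n + 2) ^ 2 / 4 = 3 * real n ^ 2 / 4 + of_int (3 * (int n + 1))"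
    by (simp add: power2_eq_square field_simps)
  then have "\<lfloor>3 * real (n + 2) ^ 2 / 4\<rfloor> = \<lfloor>3 * real n ^ 2 / 4\<rfloor> + 3 * (int n + 1)"
    by (metis floor_add_int)
  then show "Dmin 3 (n + 2) = \<lfloor>3 * real (n + 2) ^ 2 / 4\<rfloor> + 2"
    using Dmin_add_2[of 3 n] n IH by simp
qed (use Dmin_base in \<open>simp_all add: numeral_2_eq_2[symmetric]\<close>)

text \<open>Starts at n = 2, the first value with 4 \<le> n + 2; at n = 1 the sum is 4, while the
  formula would give 6.\<close>

lemma Dmin_4:
  assumes "2 \<le> n"
  shows "Dmin 4 n = int n ^ 2 + 4 + of_bool (odd n)"
proof (rule parity_induct[of _ 2, OF _ _ _ assms])
  fix n :: nat assume "2 \<le> n" and "Dmin 4 n = int n ^ 2 + 4 + of_bool (odd n)"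
  then show "Dmin 4 (n + 2) = int (n + 2) ^ 2 + 4 + of_bool (odd (n + 2))"
    using Dmin_add_2[of 4 n] by (simp add: power2_eq_square algebra_simps)
qed (use Dmin_base in \<open>simp_all add: numeral_3_eq_3[symmetric]\<close>)

lemma Dmin_diagonal: "real_of_int (Dmin m m) = (real m ^ 3 - real m) / 3"
proof (rule parity_induct[of _ 0])
  fix n :: nat assume IH: "real_of_int (Dmin n n) = (real n ^ 3 - real n) / 3"
  \<comment> \<open>Both sides grow in turn, one of them after transposing; the larger rectangle
    uses the boundary case m = n + 2 of \<open>Dmin_add_2\<close>.\<close>
  have "Dmin (n + 2) (n + 2) = Dmin n (n + 2) + int (n + 2) * (int n + 1)"
    using Dmin_add_2[of "n + 2" n] Dmin_commute[of n "n + 2"] by simp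
  also have "\<dots> = Dmin n n + int n * (int n + 1) + int (n + 2) * (int n + 1)"
    using Dmin_add_2[of n n] by simp
  finally show "real_of_int (Dmin (n + 2) (n + 2)) = (real (n + 2) ^ 3 - real (n + 2)) / 3"
    using IH by (simp add: power3_eq_cube field_simps)
qed (use Dmin_base in simp_all)

section \<open>Height functions\<close>

definition height_function :: "'a pair_pre_digraph \<Rightarrow> ('a \<Rightarrow> int) \<Rightarrow> bool" where
  "height_function G h \<longleftrightarrow> (\<forall>(u, v) \<in> parcs G. \<bar>h u - h v\<bar> = 1)"

definition height_colouring :: "'a pair_pre_digraph \<Rightarrow> ('a \<Rightarrow> int) \<Rightarrow> 'a \<Rightarrow> 3" where
  "height_colouring G h = (\<lambda>v\<in>pverts G. of_int (h v))"

lemma of_int_3_eq_iff: "(of_int a :: 3) = of_int b \<longleftrightarrow> a mod 3 = b mod 3"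
  \<comment> \<open>The numeral type \<open>3\<close> is \<open>num1 bit1\<close>, hence the
    \<open>bit1\<close> facts at \<open>num1\<close>.\<close>
  by (simp add: bit1.of_int_eq bit1.Rep_inject_sym bit1.Rep_Abs_mod[where 'a = num1, simplified])

lemma (in pair_wf_digraph) height_colouring_proper:
  assumes "height_function G h"
  shows "height_colouring G h \<in> proper_3_colourings G"
proof -
  have "height_colouring G h u \<noteq> height_colouring G h v" if "(u, v) \<in> parcs G" for u v
  proof -
    have "\<bar>h u - h v\<bar> = 1"
      using assms that by (auto simp: height_function_def)
    then have "h u mod 3 \<noteq> h v mod 3"
      by presburger
    then show ?thesis
      using in_arcsD1[OF that] in_arcsD2[OF that]
      by (simp add: height_colouring_def of_int_3_eq_iff)
  qed
  then show ?thesis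
    by (auto simp: proper_3_colourings_def height_colouring_def simp del: restrict_apply)
qed

text \<open>Moving by \<plusminus>2 realises both possible changes of colour and keeps differences
  of neighbours odd. The new difference to a neighbour is \<plusminus>1 or \<plusminus>3, and
  \<plusminus>3 would give equal colours.\<close>

lemma (in pair_wf_digraph) height_flip:
  assumes h: "height_function G h" and d: "d \<in> proper_3_colourings G"
    and v: "v \<in> pverts G" "d v \<noteq> height_colouring G h v"
    and other: "\<And>u. u \<in> pverts G \<Longrightarrow> u \<noteq> v \<Longrightarrow> d u = height_colouring G h u"
  obtains e where "\<bar>e\<bar> = 2" "height_function G (h(v := h v + e))"
    "height_colouring G (h(v := h v + e)) = d"
proof -
  obtain z where z: "d v = of_int z"
    by (cases "d v") auto
  \<comment> \<open>Modulo 3, 2 is -1 and -2 is 1, so this choice makes h v + e congruent to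
    z.\<close>
  define e :: int where "e = (if (z - h v) mod 3 = 2 then 2 else -2)"
  have e: "\<bar>e\<bar> = 2"
    by (simp add: e_def)
  have "z mod 3 \<noteq> h v mod 3"
    using v z by (simp add: height_colouring_def of_int_3_eq_iff)
  then have "\<not> 3 dvd z - h v"
    by (simp only: mod_eq_dvd_iff not_False_eq_True)
  moreover have "3 dvd y - (if y mod 3 = 2 then 2 else -2)" if "\<not> 3 dvd y" for y :: int
    using that by presburger
  ultimately have "3 dvd z - (h v + e)"
    by (simp only: e_def diff_diff_eq[symmetric])
  then have "z mod 3 = (h v + e) mod 3"
    by (simp only: mod_eq_dvd_iff)
  then have dv: "d v = of_int (h v + e)"
    using z by (simp only: of_int_3_eq_iff)
  let ?h = "h(v := h v + e)"
  have col: "height_colouring G ?h = d"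
  proof
    fix u show "height_colouring G ?h u = d u"
      using d dv other[of u] v(1)
      by (cases "u = v"; cases "u \<in> pverts G")
        (auto simp: height_colouring_def proper_3_colourings_def PiE_def extensional_def)
  qed
  have "\<bar>?h u - ?h w\<bar> = 1" if arc: "(u, w) \<in> parcs G" for u w
  proof -
    have diff: "\<bar>h u - h w\<bar> = 1"
      using h arc by (auto simp: height_function_def)
    have "d u \<noteq> d w"
      using d arc by (auto simp: proper_3_colourings_def)
    then have "?h u mod 3 \<noteq> ?h w mod 3"
      using in_arcsD1[OF arc] in_arcsD2[OF arc]
      by (simp add: col[symmetric] height_colouring_def of_int_3_eq_iff del: fun_upd_apply)
    then have "\<not> 3 dvd ?h u - ?h w"
      by (simp only: mod_eq_dvd_iff not_False_eq_True)
    moreover have "?h u - ?h w = h u - h w \<or> ?h u - ?h w = h u - h w + e \<or> ?h u - ?h w = h u - h w - e"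
      using diff by auto
    moreover have "h u - h w = 1 \<or> h u - h w = -1" "e = 2 \<or> e = -2"
      using diff e by arith+
    ultimately show ?thesis
      by (elim disjE) simp_all
  qed
  then have "height_function G ?h"
    unfolding height_function_def by blast
  with e col show ?thesis
    using that by blast
qed

section \<open>Rotations and the lifting of walks to heights\<close>

lemma rotate_rotate:
  "rotate_colouring G k (rotate_colouring G l c) = rotate_colouring G (l + k) c"
  by (auto simp: rotate_colouring_def restrict_def add.assoc)

lemma rotate_proper:
  assumes "pair_wf_digraph G" "c \<in> proper_3_colourings G"
  shows "rotate_colouring G k c \<in> proper_3_colourings G"
proof -
  interpret pair_wf_digraph G by fact
  show ?thesis
    using assms(2) by (auto simp: proper_3_colourings_def rotate_colouring_def in_arcsD1 in_arcsD2)
qed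

lemma rotation_orbit_self:
  assumes "c \<in> proper_3_colourings G"
  shows "c \<in> rotation_orbit G c"
proof -
  have "c = rotate_colouring G 0 c"
    using assms
    by (auto simp: fun_eq_iff rotate_colouring_def proper_3_colourings_def PiE_def extensional_def)
  then show ?thesis
    by (auto simp: rotation_orbit_def)
qed

lemma OFG_arc_height_flip:
  assumes arc: "(A, B) \<in> parcs (OFG m n)"
    and h: "height_function (grid_graph m n) h" and A: "height_colouring (grid_graph m n) h \<in> A"
  obtains v e where "v \<in> pverts (grid_graph m n)" "\<bar>e\<bar> = 2"
    "height_function (grid_graph m n) (h(v := h v + e))"
    "height_colouring (grid_graph m n) (h(v := h v + e)) \<in> B"
proof -
  let ?G = "grid_graph m n" let ?c = "height_colouring ?G h"
  interpret pair_graph ?G by (rule pair_graph_grid_graph)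
  from arc have "A \<in> rotation_orbit ?G ` proper_3_colourings ?G"
    "B \<in> rotation_orbit ?G ` proper_3_colourings ?G"
    "\<exists>c\<in>A. \<exists>d\<in>B. \<exists>!v. v \<in> pverts ?G \<and> c v \<noteq> d v"
    by (simp_all add: OFG_def Let_def)
  then obtain a b c d where "A = rotation_orbit ?G a" "B = rotation_orbit ?G b"
    and b: "b \<in> proper_3_colourings ?G" and "c \<in> A" "d \<in> B"
    and ex: "\<exists>!v. v \<in> pverts ?G \<and> c v \<noteq> d v"
    by blast
  then obtain k l r where c: "c = rotate_colouring ?G k a" and d: "d = rotate_colouring ?G l b"
    and r: "?c = rotate_colouring ?G r a"
    using A by (auto simp: rotation_orbit_def)
  from ex obtain v where v: "v \<in> pverts ?G" "c v \<noteq> d v"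
    and uniq: "\<And>u. u \<in> pverts ?G \<Longrightarrow> u \<noteq> v \<Longrightarrow> c u = d u"
    by metis
  \<comment> \<open>The arc provides some representative \<open>c\<close> of \<open>A\<close>, not
    necessarily the colouring of \<open>h\<close>. Rotating \<open>c\<close> and \<open>d\<close> by
    the same amount turns \<open>c\<close> into that colouring and leaves \<open>v\<close> the only
    vertex of difference.\<close>
  define d' where "d' = rotate_colouring ?G (r - k) d"
  have c': "?c = rotate_colouring ?G (r - k) c"
    by (simp add: c r rotate_rotate)
  have d'B: "d' \<in> B"
    using \<open>B = _\<close> by (auto simp: d'_def d rotate_rotate rotation_orbit_def)
  have "d' \<in> proper_3_colourings ?G"
    unfolding d'_def d by (intro rotate_proper b pair_wf_digraph_axioms)
  moreover have "d' v \<noteq> ?c v"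
    using v unfolding c' d'_def by (auto simp: rotate_colouring_def)
  moreover have "d' u = ?c u" if "u \<in> pverts ?G" "u \<noteq> v" for u
    using uniq[OF that] unfolding c' d'_def by (simp add: rotate_colouring_def)
  ultimately obtain e where "\<bar>e\<bar> = 2" "height_function ?G (h(v := h v + e))"
    "height_colouring ?G (h(v := h v + e)) = d'"
    using height_flip[OF h _ v(1)] by blast
  with d'B v(1) show ?thesis
    using that by blast
qed

text \<open>Arcs are lifted one after another, each as a flip of the current height. The end of the
  walk fixes only the orbit of \<open>g\<close>, so \<open>g\<close> itself may depend on the
  walk.\<close>

lemma OFG_walk_height:
  assumes "pre_digraph.awalk (with_proj (OFG m n)) A p B"
    and "height_function (grid_graph m n) h" "height_colouring (grid_graph m n) h \<in> A"
  obtains g where "height_function (grid_graph m n) g" "height_colouring (grid_graph m n) g \<in> B"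
    "\<And>v. even (g v - h v)"
    "(\<Sum>v\<in>pverts (grid_graph m n). \<bar>g v - h v\<bar>) \<le> 2 * int (length p)"
proof -
  let ?G = "grid_graph m n"
  interpret pair_graph "OFG m n" by (rule pair_graph_OFG)
  have "\<exists>g. height_function ?G g \<and> height_colouring ?G g \<in> B \<and> (\<forall>v. even (g v - h v)) \<and>
      (\<Sum>v\<in>pverts ?G. \<bar>g v - h v\<bar>) \<le> 2 * int (length p)"
    using assms
  proof (induction p arbitrary: A h)
    case Nil
    then have "A = B"
      by (simp add: awalk_Nil_iff)
    with Nil show ?case
      by (intro exI[of _ h]) simp
  next
    case (Cons a p)
    then have arc: "(A, snd a) \<in> parcs (OFG m n)" and walk: "awalk (snd a) p B"
      by (auto simp: awalk_Cons_iff)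
    obtain v e where v: "v \<in> pverts ?G" "\<bar>e\<bar> = 2"
      "height_function ?G (h(v := h v + e))" "height_colouring ?G (h(v := h v + e)) \<in> snd a"
      by (rule OFG_arc_height_flip[OF arc Cons.prems(2,3)])
    let ?h = "h(v := h v + e)"
    obtain g where g: "height_function ?G g" "height_colouring ?G g \<in> B"
      "\<forall>u. even (g u - ?h u)" "(\<Sum>u\<in>pverts ?G. \<bar>g u - ?h u\<bar>) \<le> 2 * int (length p)"
      using Cons.IH[OF walk v(3,4)] by blast
    have "finite (pverts ?G)"
      by (simp add: grid_graph_def)
    \<comment> \<open>Triangle inequality through the flipped height, which differs from
      \<open>h\<close> by 2 at \<open>v\<close> alone.\<close>
    have "(\<Sum>u\<in>pverts ?G. \<bar>g u - h u\<bar>)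
        \<le> (\<Sum>u\<in>pverts ?G. \<bar>g u - ?h u\<bar> + (if u = v then 2 else 0))"
      using v(2) by (intro sum_mono) auto
    also have "\<dots> = (\<Sum>u\<in>pverts ?G. \<bar>g u - ?h u\<bar>) + 2"
      using v(1) \<open>finite _\<close> by (simp add: sum.distrib)
    finally have "(\<Sum>u\<in>pverts ?G. \<bar>g u - h u\<bar>) \<le> 2 * int (length (a # p))"
      using g(4) by simp
    moreover have "even (g u - h u)" for u
    proof -
      have "even (g u - ?h u)"
        using g(3) by blast
      moreover have "even e"
        using v(2) by presburger
      ultimately show ?thesis
        by (auto split: if_splits)
    qed
    ultimately show ?case
      using g(1,2) by blast
  qed
  then show ?thesis
    using that by blast
qed

section \<open>Heights within one orbit\<close>

text \<open>Connectedness of the grid, by the path from (i, j) to (1, j) and on to (1, 1).\<close>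

lemma grid_locally_constant:
  assumes const: "\<And>u v. (u, v) \<in> parcs (grid_graph m n) \<Longrightarrow> f u = f v"
    and "i \<in> {1..m}" "j \<in> {1..n}"
  shows "f (i, j) = f (1, 1)"
proof -
  have "f (i, j) = f (1, j)"
    using assms(2)
  proof (induction i)
    case (Suc i)
    show ?case
    \<comment> \<open>Coordinates begin at 1: the base case is vacuous and the induction really
      starts at \<open>Suc 0\<close>.\<close>
    proof (cases "i = 0")
      case False
      then have "((i, j), (Suc i, j)) \<in> parcs (grid_graph m n)"
        using Suc.prems assms(3) by (simp add: grid_graph_def)
      then show ?thesis
        using const Suc False by fastforce
    qed simp
  qed simp
  also have "f (1, j) = f (1, 1)"
    using assms(3)
  proof (induction j)
    case (Suc j)
    show ?case
    proof (cases "j = 0")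
      case False
      then have "((1, j), (1, Suc j)) \<in> parcs (grid_graph m n)"
        using Suc.prems assms(2) by (simp add: grid_graph_def)
      then show ?thesis
        using const Suc False by fastforce
    qed simp
  qed simp
  finally show ?thesis .
qed

text \<open>Along an arc the rotation cancels modulo 3, and an increment \<plusminus>1 is determined
  by its residue; so both heights have the same increments.\<close>

lemma same_orbit_heights:
  assumes h: "height_function (grid_graph m n) h" and g: "height_function (grid_graph m n) g"
    and orbit: "height_colouring (grid_graph m n) h \<in>
      rotation_orbit (grid_graph m n) (height_colouring (grid_graph m n) g)"
    and "i \<in> {1..m}" "j \<in> {1..n}"
  shows "h (i, j) - g (i, j) = h (1, 1) - g (1, 1)"
proof (rule grid_locally_constant[where f = "\<lambda>v. h v - g v", OF _ assms(4,5)])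
  let ?G = "grid_graph m n"
  interpret pair_graph ?G by (rule pair_graph_grid_graph)
  obtain k where "height_colouring ?G h = rotate_colouring ?G k (height_colouring ?G g)"
    using orbit by (auto simp: rotation_orbit_def)
  moreover obtain z where "k = of_int z"
    by (cases k) auto
  ultimately have col: "height_colouring ?G h = rotate_colouring ?G (of_int z) (height_colouring ?G g)"
    by simp
  have eq: "h v mod 3 = (g v + z) mod 3" if "v \<in> pverts ?G" for v
    using that fun_cong[OF col, of v]
    by (simp add: height_colouring_def rotate_colouring_def flip: of_int_3_eq_iff)
  fix u v assume arc: "(u, v) \<in> parcs ?G"
  have "h u mod 3 = (g u + z) mod 3" "h v mod 3 = (g v + z) mod 3"
    using eq in_arcsD1[OF arc] in_arcsD2[OF arc] by auto
  then have "((g u + z) - (g v + z)) mod 3 = (h u - h v) mod 3"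
    by (intro mod_diff_cong) simp_all
  then have mod: "(g u - g v) mod 3 = (h u - h v) mod 3"
    by simp
  have "\<bar>h u - h v\<bar> = 1" "\<bar>g u - g v\<bar> = 1"
    using h g arc by (auto simp: height_function_def)
  then have "h u - h v = 1 \<or> h u - h v = -1" "g u - g v = 1 \<or> g u - g v = -1"
    by arith+
  with mod have "h u - h v = g u - g v"
    by auto
  then show "h u - g u = h v - g v"
    by simp
qed

section \<open>The lower bound for the diameter\<close>

lemma Dmin_le_diameter:
  assumes "m \<ge> 1" "n \<ge> 1"
  shows "ereal (real_of_int (Dmin m n)) \<le> graph_diameter (OFG m n)"
proof -
  let ?G = "grid_graph m n"
  interpret G: pair_graph ?G by (rule pair_graph_grid_graph)
  interpret pair_graph "OFG m n" by (rule pair_graph_OFG)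
  define h :: "nat \<times> nat \<Rightarrow> int" where "h = (\<lambda>(i, j). int i + int j)"
  define g :: "nat \<times> nat \<Rightarrow> int" where "g = (\<lambda>(i, j). - (int i + int j))"
  have h: "height_function ?G h" and g: "height_function ?G g"
    by (auto simp: height_function_def grid_graph_def h_def g_def)
  let ?A = "rotation_orbit ?G (height_colouring ?G h)"
  let ?B = "rotation_orbit ?G (height_colouring ?G g)"
  have in_A: "height_colouring ?G h \<in> ?A"
    by (intro rotation_orbit_self G.height_colouring_proper h)
  have "Dmin m n \<le> int (length p)" if walk: "awalk ?A p ?B" for p
  proof -
    obtain f where f: "height_function ?G f" "height_colouring ?G f \<in> ?B"
      "\<And>v. even (f v - h v)" "(\<Sum>v\<in>pverts ?G. \<bar>f v - h v\<bar>) \<le> 2 * int (length p)"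
      using OFG_walk_height[OF walk h in_A] by blast
    define C where "C = f (1, 1) - g (1, 1)"
    have fg: "f (i, j) = g (i, j) + C" if "i \<in> {1..m}" "j \<in> {1..n}" for i j
      using same_orbit_heights[OF f(1) g f(2) that] by (simp add: C_def)
    \<comment> \<open>At (1, 1) both f - h and g - h = -4 are even.\<close>
    have "even C"
      using f(3)[of "(1, 1)"] fg[of 1 1] assms by (simp add: g_def h_def)
    then obtain K where K: "C = 2 * K" ..
    \<comment> \<open>Here f - h = 2K - 2(i + j), so half of the offset \<open>C\<close> is the K of
      the median sum.\<close>
    have "2 * grid_sum m n K = (\<Sum>i=1..m. \<Sum>j=1..n. \<bar>f (i, j) - h (i, j)\<bar>)"
      unfolding grid_sum_def sum_distrib_left
      by (intro sum.cong refl) (simp add: fg g_def h_def K, arith)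
    also have "\<dots> = (\<Sum>v\<in>pverts ?G. \<bar>f v - h v\<bar>)"
      by (simp add: sum.cartesian_product grid_graph_def case_prod_unfold)
    finally show ?thesis
      using f(4) Dmin_le[of m n K] by linarith
  qed
  then have "ereal (real_of_int (Dmin m n)) \<le> ereal (awalk_cost (\<lambda>_. 1) p)" if "awalk ?A p ?B" for p
    using that by (force simp: awalk_cost_def sum_list_triv)
  then have "ereal (real_of_int (Dmin m n)) \<le> graph_dist (OFG m n) ?A ?B"
    \<comment> \<open>\<open>\<mu>\<close> is an infimum over walks, so a bound valid for every walk
      passes to it.\<close>
    unfolding graph_dist_def \<mu>_def by (intro INF_greatest) simp
  also have "\<dots> \<le> graph_diameter (OFG m n)"
    unfolding graph_diameter_def
    by (rule SUP_upper2[of "(?A, ?B)"])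
      (auto simp: OFG_def Let_def intro: G.height_colouring_proper h g)
  finally show ?thesis .
qed

theorem theorem4p1:
  shows "(\<forall>m n. m \<ge> 1 \<and> n \<ge> 1 \<longrightarrow>
            graph_diameter (OFG m n) \<ge> ereal (real_of_int (Dmin m n))) \<and>
         (\<forall>m n. m \<ge> 1 \<and> n \<ge> 1 \<longrightarrow> Dmin m n = Dmin n m) \<and>
         (\<forall>n\<ge>1. Dmin 2 n = \<lceil>real n ^ 2 / 2\<rceil>) \<and>
         (\<forall>n\<ge>1. Dmin 3 n = \<lfloor>3 * real n ^ 2 / 4\<rfloor> + 2) \<and>
         (\<forall>n\<ge>2. Dmin 4 n = int n ^ 2 + 4 + of_bool (odd n)) \<and>
         (\<forall>m\<ge>1. real_of_int (Dmin m m) = (real m ^ 3 - real m) / 3)"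
  using Dmin_le_diameter Dmin_commute Dmin_2 Dmin_3 Dmin_4 Dmin_diagonal by blast

end
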